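(* Let $X$ and $Y$ be real normed spaces and let $f \colon X\to Y$ be a surjective mapping. Then $f$ satisfies $$\{\|f(x)+f(y)\|,\|f(x)-f(y)\|\}=\{\|x+y\|,\|x-y\|\}\quad\text{for all } x,y\in X$$ if and only if $f$ is phase equivalent to a surjective linear isometry, that is, if and only if there exist a surjective linear isometry $U\colon X\to Y$ and a function $\sigma\colon X\to\{-1,1\}$ such that $f(x)=\sigma(x)Ux$ for all $x\in X$.
   Context: The displayed identity is an equality of (unordered) sets of real numbers. No assumption is made on the dimension or completeness of $X$ and $Y$. *)

theory Defs
  imports "HOL-Analysis.Analysis"
begin

end

(* A phase isometry f is odd and preserves norms. Near a nonzero x its sign can be normalised so
   that it becomes an isometry of one ball onto another, which a local form of the Mazur-Ulam
   theorem shows to be affine on a smaller ball; so f = A or f = -A pointwise there, A affine. Two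
   affine maps that agree up to a pointwise sign on a ball agree globally up to one sign, hence A can
   be continued along every segment from x that avoids 0. Continuation towards 0 gives A 0 = 0, and
   every nonzero y is reached by the segment from x to y or, using oddness, by the one to -y. *)
theory Submission
  imports Defs
begin

section \<open>Midpoints under isometries of centrally symmetric sets\<close>

text \<open>Vaisala's reflection argument: each such \<open>h\<close> yields another one that moves
  the midpoint exactly twice as far. Since the displacement is bounded uniformly over all such
  \<open>h\<close>, it must vanish.\<close>

lemma isometry_fixes_symmetry_centre:
  fixes C :: "'a::real_normed_vector set"
  assumes sym: "\<And>z. z \<in> C \<Longrightarrow> a + b - z \<in> C"
    and a: "a \<in> C" and b: "b \<in> C" and m: "midpoint a b \<in> C"
    and h: "bij_betw h C C" "\<And>y z. y \<in> C \<Longrightarrow> z \<in> C \<Longrightarrow> dist (h y) (h z) = dist y z"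
      "h a = a" "h b = b"
  shows "h (midpoint a b) = midpoint a b"
proof -
  define m where "m = midpoint a b"
  have mm: "a + b - m = m" unfolding m_def by (metis add_diff_cancel midpoint_plus_self)
  have mC: "m \<in> C" using m m_def by simp
  define W where "W = {h. bij_betw h C C \<and> (\<forall>y\<in>C. \<forall>z\<in>C. dist (h y) (h z) = dist y z) \<and> h a = a \<and> h b = b}"
  \<comment> \<open>The quantifier over \<open>W\<close> stays inside the induction, because the
    step applies the hypothesis to a different isometry \<open>h'\<close>.\<close>
  have bound: "\<forall>h\<in>W. 2^n * dist (h m) m \<le> 2 * dist m a" for n :: nat
  proof (induction n)
    case 0
    show ?case
    proof
      fix h assume "h \<in> W"
      then have "dist (h m) a = dist m a" using a mC unfolding W_def by (metis (mono_tags, lifting) mem_Collect_eq)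
      then show "2^0 * dist (h m) m \<le> 2 * dist m a"
        using dist_triangle2[of "h m" m a] by simp
    qed
  next
    case (Suc n)
    show ?case
    proof
      fix h assume "h \<in> W"
      then have bij: "bij_betw h C C" and iso: "\<And>y z. y \<in> C \<Longrightarrow> z \<in> C \<Longrightarrow> dist (h y) (h z) = dist y z"
        and ha: "h a = a" and hb: "h b = b"
        unfolding W_def by auto
      define \<rho> where "\<rho> z = a + b - z" for z
      define k where "k = inv_into C h"
      have \<rho>bij: "bij_betw \<rho> C C"
        by (rule bij_betw_byWitness[of _ \<rho>]) (auto simp: \<rho>_def sym)
      have kbij: "bij_betw k C C" unfolding k_def by (rule bij_betw_inv_into[OF bij])
      have kC: "\<And>z. z \<in> C \<Longrightarrow> k z \<in> C" using kbij bij_betwE by blast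
      have hC: "\<And>z. z \<in> C \<Longrightarrow> h z \<in> C" using bij bij_betwE by blast
      have hk: "\<And>z. z \<in> C \<Longrightarrow> h (k z) = z" unfolding k_def by (rule bij_betw_inv_into_right[OF bij])
      have kh: "\<And>z. z \<in> C \<Longrightarrow> k (h z) = z" unfolding k_def by (rule bij_betw_inv_into_left[OF bij])
      have kiso: "\<And>y z. y \<in> C \<Longrightarrow> z \<in> C \<Longrightarrow> dist (k y) (k z) = dist y z"
        using iso kC hk by metis
      have \<rho>iso: "\<And>y z. dist (\<rho> y) (\<rho> z) = dist y z" by (simp add: \<rho>_def dist_norm norm_minus_commute)
      have \<rho>C: "\<And>z. z \<in> C \<Longrightarrow> \<rho> z \<in> C" by (simp add: \<rho>_def sym)
      have \<rho>m: "\<rho> m = m" using mm by (simp add: \<rho>_def)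
      \<comment> \<open>With \<open>k\<close> inverse to \<open>h\<close>, conjugating
        \<open>k\<close> by the reflection \<open>\<rho>\<close> and composing with \<open>h\<close>
        keeps \<open>a\<close> and \<open>b\<close> fixed. The distance from \<open>h' m\<close> to
        \<open>m\<close> is that from \<open>h m\<close> to its own reflection, which is twice that
        from \<open>h m\<close> to the centre \<open>m\<close>.\<close>
      define h' where "h' = \<rho> \<circ> (k \<circ> (\<rho> \<circ> h))"
      have "bij_betw h' C C" unfolding h'_def
        by (intro bij_betw_trans[of _ C C _ C] bij kbij \<rho>bij)
      moreover have "dist (h' y) (h' z) = dist y z" if "y \<in> C" "z \<in> C" for y z
        using that by (simp add: h'_def \<rho>iso kiso \<rho>C hC iso)
      moreover have "h' a = a" "h' b = b"
        using kh[OF a] kh[OF b] by (auto simp: h'_def ha hb \<rho>_def)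
      ultimately have "h' \<in> W" unfolding W_def by auto
      then have le: "2^n * dist (h' m) m \<le> 2 * dist m a" using Suc by blast
      have "dist (h' m) m = dist (k (\<rho> (h m))) m"
        by (metis \<rho>iso \<rho>m h'_def comp_apply)
      also have "\<dots> = dist (k (\<rho> (h m))) (k (h m))" by (simp add: kh mC)
      also have "\<dots> = dist (\<rho> (h m)) (h m)" by (simp add: kiso \<rho>C hC mC)
      also have "\<dots> = norm (2 *\<^sub>R (m - h m))"
      proof -
        have "a + b = m + m" using mm by (simp add: algebra_simps)
        then show ?thesis by (simp add: dist_norm \<rho>_def scaleR_2 algebra_simps)
      qed
      also have "\<dots> = 2 * dist (h m) m" by (simp add: dist_norm norm_minus_commute)
      finally show "2 ^ Suc n * dist (h m) m \<le> 2 * dist m a" using le by simp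
    qed
  qed
  have "h \<in> W" unfolding W_def using h by auto
  then have "\<And>n::nat. 2^n * dist (h m) m \<le> 2 * dist m a" using bound by blast
  moreover have "\<exists>n::nat. 2 * dist m a < 2^n * dist (h m) m" if "dist (h m) m > 0"
    using real_arch_pow[of 2 "2 * dist m a / dist (h m) m"] that by (auto simp: field_simps)
  ultimately have "dist (h m) m \<le> 0" by (meson not_le)
  then show ?thesis by (simp add: m_def)
qed

text \<open>Going to \<open>D\<close> by \<open>g\<close>, reflecting there, returning by the
  inverse and reflecting in \<open>C\<close> is a self-isometry of \<open>C\<close> fixing
  \<open>a\<close> and \<open>b\<close>. It therefore fixes the midpoint, so the image of the
  midpoint is fixed by the reflection of \<open>D\<close>.\<close>

lemma isometry_between_symmetric_sets_midpoint:
  fixes C :: "'a::real_normed_vector set" and D :: "'b::real_normed_vector set"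
  assumes symC: "\<And>z. z \<in> C \<Longrightarrow> a + b - z \<in> C"
    and symD: "\<And>z. z \<in> D \<Longrightarrow> g a + g b - z \<in> D"
    and a: "a \<in> C" and b: "b \<in> C" and m: "midpoint a b \<in> C"
    and bij: "bij_betw g C D" and iso: "\<And>y z. y \<in> C \<Longrightarrow> z \<in> C \<Longrightarrow> dist (g y) (g z) = dist y z"
  shows "g (midpoint a b) = midpoint (g a) (g b)"
proof -
  define k where "k = inv_into C g"
  define \<rho> where "\<rho> z = a + b - z" for z
  define \<tau> where "\<tau> z = g a + g b - z" for z
  define h where "h = \<rho> \<circ> (k \<circ> (\<tau> \<circ> g))"
  define m where "m = midpoint a b"
  have \<rho>bij: "bij_betw \<rho> C C"
    by (rule bij_betw_byWitness[of _ \<rho>]) (auto simp: \<rho>_def symC)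
  have \<tau>bij: "bij_betw \<tau> D D"
    by (rule bij_betw_byWitness[of _ \<tau>]) (auto simp: \<tau>_def symD)
  have kbij: "bij_betw k D C" unfolding k_def by (rule bij_betw_inv_into[OF bij])
  have kC: "\<And>z. z \<in> D \<Longrightarrow> k z \<in> C" using kbij bij_betwE by blast
  have gD: "\<And>z. z \<in> C \<Longrightarrow> g z \<in> D" using bij bij_betwE by blast
  have gk: "\<And>z. z \<in> D \<Longrightarrow> g (k z) = z" unfolding k_def by (rule bij_betw_inv_into_right[OF bij])
  have kg: "\<And>z. z \<in> C \<Longrightarrow> k (g z) = z" unfolding k_def by (rule bij_betw_inv_into_left[OF bij])
  have kiso: "\<And>y z. y \<in> D \<Longrightarrow> z \<in> D \<Longrightarrow> dist (k y) (k z) = dist y z"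
    using iso kC gk by metis
  have \<tau>D: "\<And>z. z \<in> D \<Longrightarrow> \<tau> z \<in> D" by (simp add: \<tau>_def symD)
  have "h m = m" unfolding m_def
  proof (rule isometry_fixes_symmetry_centre[OF symC a b m])
    show "bij_betw h C C" unfolding h_def
      by (rule bij_betw_trans[OF bij_betw_trans[OF bij_betw_trans[OF bij \<tau>bij] kbij] \<rho>bij])
    fix y z assume yz: "y \<in> C" "z \<in> C"
    have "dist (h y) (h z) = dist (k (\<tau> (g y))) (k (\<tau> (g z)))"
      by (simp add: h_def \<rho>_def dist_norm norm_minus_commute)
    also have "\<dots> = dist (\<tau> (g y)) (\<tau> (g z))" by (simp add: kiso \<tau>D gD yz)
    also have "\<dots> = dist (g y) (g z)" by (simp add: \<tau>_def dist_norm norm_minus_commute)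
    also have "\<dots> = dist y z" by (simp add: iso yz)
    finally show "dist (h y) (h z) = dist y z" .
  next
    show "h a = a" "h b = b" using kg[OF a] kg[OF b] by (auto simp: h_def \<rho>_def \<tau>_def)
  qed
  then have "\<rho> (k (\<tau> (g m))) = m" by (simp add: h_def)
  then have "k (\<tau> (g m)) = a + b - m" by (auto simp: \<rho>_def algebra_simps)
  also have "\<dots> = m" unfolding m_def by (metis add_diff_cancel midpoint_plus_self)
  finally have "\<tau> (g m) = g m" using gk \<tau>D gD m m_def by metis
  then have "g a + g b = g m + g m" by (auto simp: \<tau>_def algebra_simps)
  then show ?thesis using midpoint_eq_iff m_def by metis
qed

text \<open>A local version of the Mazur-Ulam theorem: balls of radius \<^term>\<open>dist a b\<close> around
  \<^term>\<open>a\<close> and \<^term>\<open>b\<close> stay inside the large ball, and their intersection is symmetric about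
  the midpoint.\<close>
lemma ball_isometry_midpoint:
  fixes g :: "'a::real_normed_vector \<Rightarrow> 'b::real_normed_vector"
  assumes img: "g ` ball x r = ball (g x) r"
    and iso: "\<And>y z. y \<in> ball x r \<Longrightarrow> z \<in> ball x r \<Longrightarrow> dist (g y) (g z) = dist y z"
    and a: "a \<in> ball x (r/3)" and b: "b \<in> ball x (r/3)"
  shows "g (midpoint a b) = midpoint (g a) (g b)"
proof -
  define R where "R = dist a b"
  define C where "C = cball a R \<inter> cball b R"
  define D where "D = cball (g a) R \<inter> cball (g b) R"
  have ax: "dist x a < r/3" and bx: "dist x b < r/3" using a b by auto
  have "0 \<le> dist x a" by simp
  then have r: "r > 0" using ax by linarith
  have R: "R < 2/3 * r" using dist_triangle3[of a b x] ax bx by (simp add: R_def)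
  have abr: "a \<in> ball x r" "b \<in> ball x r" "x \<in> ball x r" using ax bx r by auto
  have Csub: "C \<subseteq> ball x r"
  proof
    fix z assume "z \<in> C"
    then have "dist a z \<le> R" by (simp add: C_def)
    then show "z \<in> ball x r" using dist_triangle[of x z a] ax R by simp
  qed
  have gab: "dist (g a) (g b) = R" using iso abr R_def by simp
  have gax: "dist (g x) (g a) = dist x a" using iso abr by simp
  have Dsub: "D \<subseteq> ball (g x) r"
  proof
    fix z assume "z \<in> D"
    then have "dist (g a) z \<le> R" by (simp add: D_def)
    then show "z \<in> ball (g x) r" using dist_triangle[of "g x" z "g a"] ax R gax by simp
  qed
  show ?thesis
  proof (rule isometry_between_symmetric_sets_midpoint[of C a b D g])
    fix z assume "z \<in> C"
    then show "a + b - z \<in> C" by (auto simp: C_def dist_norm algebra_simps norm_minus_commute)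
  next
    fix z assume "z \<in> D"
    then show "g a + g b - z \<in> D" by (auto simp: D_def dist_norm algebra_simps norm_minus_commute)
  next
    show "a \<in> C" "b \<in> C" by (auto simp: C_def R_def dist_commute)
    show "midpoint a b \<in> C" by (auto simp: C_def R_def dist_midpoint)
    show "bij_betw g C D"
    proof (rule bij_betw_imageI)
      show "inj_on g C" 
        by (rule inj_onI) (metis Csub dist_eq_0_iff iso subsetD)
      show "g ` C = D"
      proof
        show "g ` C \<subseteq> D"
          using Csub abr by (auto simp: C_def D_def iso)
        \<comment> \<open>A point of \<open>D\<close> has a preimage in the large ball by
          \<open>img\<close>. Distances to \<open>a\<close> and \<open>b\<close> are preserved, so
          this preimage lies in \<open>C\<close>.\<close>
        show "D \<subseteq> g ` C"
        proof
          fix w assume w: "w \<in> D"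
          then obtain z where z: "z \<in> ball x r" "w = g z" using Dsub img by blast
          then have "z \<in> C" using w abr by (simp add: C_def D_def iso del: mem_ball)
          then show "w \<in> g ` C" using z by blast
        qed
      qed
    qed
    show "dist (g y) (g z) = dist y z" if "y \<in> C" "z \<in> C" for y z
      using that Csub iso by blast
  qed
qed

section \<open>From midpoint preservation on a ball to linearity\<close>

text \<open>The defect \<open>h (t *\<^sub>R v) - t *\<^sub>R h v\<close> is half the defect at the
  image of \<open>t\<close> under the doubling map of the unit interval. Defects are bounded by
  \<open>2 * norm v\<close>, so repeated doubling forces them to be zero.\<close>

lemma midpoint_affine_scaleR:
  fixes h :: "'a::real_normed_vector \<Rightarrow> 'b::real_normed_vector"
  assumes mid: "\<And>u v. u \<in> ball 0 s \<Longrightarrow> v \<in> ball 0 s \<Longrightarrow> h (midpoint u v) = midpoint (h u) (h v)"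
    and bnd: "\<And>v. v \<in> ball 0 s \<Longrightarrow> norm (h v) \<le> norm v"
    and v: "v \<in> ball 0 s" and t: "0 \<le> t" "t \<le> 1"
  shows "h (t *\<^sub>R v) = t *\<^sub>R h v"
proof -
  have tv: "t *\<^sub>R v \<in> ball 0 s" if "0 \<le> t" "t \<le> 1" for t
    using that v mult_left_le_one_le[of "norm v" t] by simp
  have h0: "h 0 = 0" using bnd[of 0] tv[of 0] by simp
  have "\<forall>t. 0 \<le> t \<longrightarrow> t \<le> 1 \<longrightarrow> 2^n * norm (h (t *\<^sub>R v) - t *\<^sub>R h v) \<le> 2 * norm v" for n :: nat
  proof (induction n)
    case 0
    show ?case
    proof (intro allI impI)
      fix t :: real assume t: "0 \<le> t" "t \<le> 1"
      have "norm (h (t *\<^sub>R v)) \<le> norm v"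
        using bnd[OF tv[OF t]] mult_left_le_one_le[of "norm v" t] t by simp
      moreover have "norm (t *\<^sub>R h v) \<le> norm v"
        using bnd[OF v] mult_left_le_one_le[of "norm (h v)" t] t by simp
      ultimately show "2^0 * norm (h (t *\<^sub>R v) - t *\<^sub>R h v) \<le> 2 * norm v"
        using norm_triangle_ineq4[of "h (t *\<^sub>R v)" "t *\<^sub>R h v"] by simp
    qed
  next
    case (Suc n)
    show ?case
    proof (intro allI impI)
      fix t :: real assume t: "0 \<le> t" "t \<le> 1"
      \<comment> \<open>The witness is \<open>2*t\<close> or \<open>2*t-1\<close>: the point
        \<open>t *\<^sub>R v\<close> is the midpoint of \<open>0\<close> and
        \<open>(2*t) *\<^sub>R v\<close>, and also of \<open>v\<close> and
        \<open>(2*t-1) *\<^sub>R v\<close>.\<close>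
      have "\<exists>t'. 0 \<le> t' \<and> t' \<le> 1 \<and> h (t *\<^sub>R v) - t *\<^sub>R h v = (1/2) *\<^sub>R (h (t' *\<^sub>R v) - t' *\<^sub>R h v)"
      proof (cases "t \<le> 1/2")
        case True
        have "h (t *\<^sub>R v) = h (midpoint 0 ((2*t) *\<^sub>R v))" by (simp add: midpoint_def)
        also have "\<dots> = midpoint (h 0) (h ((2*t) *\<^sub>R v))"
          using mid[OF tv[of 0] tv[of "2*t"]] True t by simp
        finally have "h (t *\<^sub>R v) - t *\<^sub>R h v = (1/2) *\<^sub>R (h ((2*t) *\<^sub>R v) - (2*t) *\<^sub>R h v)"
          by (simp add: midpoint_def h0 algebra_simps)
        then show ?thesis using True t by (intro exI[of _ "2*t"]) auto
      next
        case False
        have "midpoint v ((2*t-1) *\<^sub>R v) = t *\<^sub>R v"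
          by (simp add: midpoint_def algebra_simps flip: scaleR_add_left)
        then have "h (t *\<^sub>R v) = midpoint (h v) (h ((2*t-1) *\<^sub>R v))"
          using mid[OF v tv[of "2*t-1"]] False t by simp
        then have "h (t *\<^sub>R v) - t *\<^sub>R h v = (1/2) *\<^sub>R (h ((2*t-1) *\<^sub>R v) - (2*t-1) *\<^sub>R h v)"
          by (simp add: midpoint_def algebra_simps)
        then show ?thesis using False t by (intro exI[of _ "2*t-1"]) auto
      qed
      then obtain t' where t': "0 \<le> t'" "t' \<le> 1"
        and e: "h (t *\<^sub>R v) - t *\<^sub>R h v = (1/2) *\<^sub>R (h (t' *\<^sub>R v) - t' *\<^sub>R h v)" by blast
      show "2 ^ Suc n * norm (h (t *\<^sub>R v) - t *\<^sub>R h v) \<le> 2 * norm v"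
        unfolding e using Suc t' by simp
    qed
  qed
  then have *: "\<And>n::nat. 2^n * norm (h (t *\<^sub>R v) - t *\<^sub>R h v) \<le> 2 * norm v" using t by blast
  have "norm (h (t *\<^sub>R v) - t *\<^sub>R h v) \<le> 0"
  proof (rule ccontr)
    assume "\<not> ?thesis"
    then have p: "norm (h (t *\<^sub>R v) - t *\<^sub>R h v) > 0" by simp
    obtain n :: nat where "2 * norm v / norm (h (t *\<^sub>R v) - t *\<^sub>R h v) < 2^n"
      using real_arch_pow[of 2] by auto
    then show False using *[of n] p by (simp add: field_simps)
  qed
  then show ?thesis by simp
qed

text \<open>The extension shrinks a vector into the ball, applies \<open>h\<close> and scales back.
  Homogeneity for factors in the unit interval makes this independent of the shrinking
  factor.\<close>

lemma midpoint_affine_extends_linear: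
  fixes h :: "'a::real_normed_vector \<Rightarrow> 'b::real_normed_vector"
  assumes s: "s > 0"
    and mid: "\<And>u v. u \<in> ball 0 s \<Longrightarrow> v \<in> ball 0 s \<Longrightarrow> h (midpoint u v) = midpoint (h u) (h v)"
    and bnd: "\<And>v. v \<in> ball 0 s \<Longrightarrow> norm (h v) \<le> norm v"
  obtains L where "linear L" "\<And>v. v \<in> ball 0 s \<Longrightarrow> h v = L v"
proof -
  \<comment> \<open>The summand 1 avoids division by zero and puts the shrunken vector strictly
    inside the ball.\<close>
  define \<epsilon> where "\<epsilon> v = s / (1 + norm v)" for v :: 'a
  define L where "L v = (1 / \<epsilon> v) *\<^sub>R h (\<epsilon> v *\<^sub>R v)" for v
  have eb: "\<epsilon> v > 0 \<and> \<epsilon> v *\<^sub>R v \<in> ball 0 s" for v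
    using s norm_ge_zero[of v] by (simp add: \<epsilon>_def field_simps add_pos_nonneg)
  note scale = midpoint_affine_scaleR[of s h, OF mid bnd]
  have indep: "(1/d) *\<^sub>R h (d *\<^sub>R v) = (1/e) *\<^sub>R h (e *\<^sub>R v)"
    if "0 < d" "d \<le> e" "e *\<^sub>R v \<in> ball 0 s" for d e v
    using scale[of "e *\<^sub>R v" "d/e"] that by simp
  have L: "L v = (1/e) *\<^sub>R h (e *\<^sub>R v)" if "e > 0" "e *\<^sub>R v \<in> ball 0 s" for e v
    unfolding L_def using indep[of e "\<epsilon> v" v] indep[of "\<epsilon> v" e v] eb[of v] that
    by (metis linear)
  have add: "L (v + w) = L v + L w" for v w
  proof -
    define K where "K = 1 + norm v + norm w"
    \<comment> \<open>Small enough that \<open>(2*e) *\<^sub>R v\<close>,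
      \<open>(2*e) *\<^sub>R w\<close> and their midpoint \<open>e *\<^sub>R (v + w)\<close> all lie
      in the ball, so that one use of \<open>mid\<close> gives additivity.\<close>
    define e where "e = s / (2 * K)"
    have K: "K > 0" by (simp add: K_def add_pos_nonneg)
    then have e: "e > 0" using s by (simp add: e_def)
    have "2 * e * K = s" using K by (simp add: e_def)
    then have es: "2 * e + 2 * e * norm v + 2 * e * norm w = s" by (simp add: K_def algebra_simps)
    have nn: "e * norm v \<ge> 0" "e * norm w \<ge> 0" using e by auto
    have 1: "(2*e) *\<^sub>R v \<in> ball 0 s" "(2*e) *\<^sub>R w \<in> ball 0 s"
      using e es nn by (auto simp: add_pos_nonneg)
    have "norm (e *\<^sub>R (v + w)) \<le> e * norm v + e * norm w"
      using e norm_triangle_ineq[of v w] by (simp flip: distrib_left)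
    then have "norm (e *\<^sub>R (v + w)) < s" using e es nn by linarith
    then have 2: "e *\<^sub>R (v + w) \<in> ball 0 s" by simp
    have "e *\<^sub>R (v + w) = midpoint ((2*e) *\<^sub>R v) ((2*e) *\<^sub>R w)"
      by (simp add: midpoint_def scaleR_add_right)
    then have "h (e *\<^sub>R (v + w)) = midpoint (h ((2*e) *\<^sub>R v)) (h ((2*e) *\<^sub>R w))"
      using mid[OF 1] by simp
    then show ?thesis
      using L[OF e 2] L[OF _ 1(1)] L[OF _ 1(2)] e
      by (simp add: midpoint_def scaleR_add_right mult.commute)
  qed
  have L0: "L 0 = 0" using add[of 0 0] by simp
  have pos: "L (c *\<^sub>R v) = c *\<^sub>R L v" if "c > 0" for c v
  proof -
    define e where "e = \<epsilon> (c *\<^sub>R v)"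
    have e: "e > 0" "e *\<^sub>R c *\<^sub>R v \<in> ball 0 s" unfolding e_def using eb[of "c *\<^sub>R v"] by blast+
    have "(e * c) *\<^sub>R v \<in> ball 0 s" using e(2) by (simp only: scaleR_scaleR)
    then have "L v = (1 / (e * c)) *\<^sub>R h ((e * c) *\<^sub>R v)" using L e(1) that by simp
    then show ?thesis using L[OF e] e(1) that by simp
  qed
  have neg: "L (- v) = - L v" for v using add[of v "-v"] L0 by (simp add: eq_neg_iff_add_eq_0 add.commute)
  have "linear L"
  proof (rule linearI)
    show "L (c *\<^sub>R v) = c *\<^sub>R L v" for c v
    proof (cases c "0::real" rule: linorder_cases)
      case less
      then have "L (c *\<^sub>R v) = - L ((-c) *\<^sub>R v)" using neg[of "(-c) *\<^sub>R v"] by simp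
      also have "\<dots> = c *\<^sub>R L v" using pos[of "-c" v] less by simp
      finally show ?thesis .
    qed (auto simp: L0 pos)
  qed (rule add)
  moreover have "h v = L v" if "v \<in> ball 0 s" for v using L[of 1 v] that by simp
  ultimately show thesis using that by blast
qed

section \<open>Rigidity of affine maps, and segments avoiding the origin\<close>

lemma affine_eq_of_eq_on_ball:
  fixes L M :: "'a::real_normed_vector \<Rightarrow> 'b::real_normed_vector"
  assumes "linear L" "linear M" "s > 0"
    and eq: "\<And>y. y \<in> ball p s \<Longrightarrow> c + L y = d + M y"
  shows "c + L z = d + M z"
proof -
  \<comment> \<open>Moving from \<open>p\<close> towards \<open>z\<close> by this fraction stays in
    the ball. Agreement there and at \<open>p\<close> makes the linear parts agree on
    \<open>z - p\<close>.\<close>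
  define e where "e = s / (1 + norm (z - p))"
  have e: "e > 0" using assms by (simp add: e_def add_pos_nonneg)
  have "1 + norm (z - p) > 0" by (simp add: add_pos_nonneg)
  then have "e * (1 + norm (z - p)) = s" by (simp add: e_def)
  then have "e * norm (z - p) < s" using e by (simp add: algebra_simps)
  then have "p + e *\<^sub>R (z - p) \<in> ball p s" using e by (simp add: dist_norm)
  then have 1: "c + L (p + e *\<^sub>R (z - p)) = d + M (p + e *\<^sub>R (z - p))" by (rule eq)
  have 2: "c + L p = d + M p" using eq assms(3) by simp
  have "e *\<^sub>R (L (z - p)) = e *\<^sub>R (M (z - p))"
    using 1 2 assms(1,2) by (simp add: linear_add linear_scale flip: add.assoc)
  then have "L (z - p) = M (z - p)" using e by simp
  then show ?thesis using 2 assms(1,2) by (metis (no_types, lifting) add.assoc diff_add_cancel add.commute linear_add)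
qed

text \<open>If both signs failed somewhere on the ball, take one point where only minus holds and
  one where only plus holds. Whichever sign holds at their midpoint is then forced on both
  endpoints, a contradiction.\<close>

lemma affine_eq_up_to_sign_of_ball:
  fixes L M :: "'a::real_normed_vector \<Rightarrow> 'b::real_normed_vector"
  assumes L: "linear L" and M: "linear M" and s: "s > 0"
    and eq: "\<And>y. y \<in> ball p s \<Longrightarrow> c + L y = d + M y \<or> c + L y = - (d + M y)"
  shows "(\<forall>z. c + L z = d + M z) \<or> (\<forall>z. c + L z = - (d + M z))"
proof -
  have mid: "c + L (midpoint u v) = midpoint (c + L u) (c + L v)"
    "d + M (midpoint u v) = midpoint (d + M u) (d + M v)" for u v
    using L M by (simp_all add: midpoint_def linear_add linear_scale algebra_simps flip: scaleR_add_left)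
  have third: "u = v" if "midpoint q u = midpoint q v" for q u v :: 'b
    using that by (simp add: midpoint_def)
  have neg: "midpoint (- u) (- v) = - midpoint u v" for u v :: 'b
    by (simp add: midpoint_def algebra_simps)
  have "(\<forall>y\<in>ball p s. c + L y = d + M y) \<or> (\<forall>y\<in>ball p s. c + L y = - (d + M y))"
  proof (rule ccontr)
    assume "\<not> ?thesis"
    then obtain u v where u: "u \<in> ball p s" "c + L u \<noteq> d + M u"
      and v: "v \<in> ball p s" "c + L v \<noteq> - (d + M v)" by blast
    have eu: "c + L u = - (d + M u)" and ev: "c + L v = d + M v" using eq u v by blast+
    have "midpoint u v \<in> ball p s"
      using u v midpoint_in_closed_segment convex_ball by (metis convex_contains_segment subsetD)
    from eq[OF this] show False
    proof
      assume "c + L (midpoint u v) = d + M (midpoint u v)"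
      then have "midpoint (c + L v) (c + L u) = midpoint (c + L v) (d + M u)"
        unfolding mid by (simp add: ev midpoint_sym)
      then show False using third u by blast
    next
      assume "c + L (midpoint u v) = - (d + M (midpoint u v))"
      then have "midpoint (c + L u) (c + L v) = midpoint (c + L u) (- (d + M v))"
        unfolding mid by (simp add: eu flip: neg)
      then show False using third v by blast
    qed
  qed
  then show ?thesis
  proof
    assume "\<forall>y\<in>ball p s. c + L y = d + M y"
    then show ?thesis using affine_eq_of_eq_on_ball[OF L M s, of p c d] by blast
  next
    assume *: "\<forall>y\<in>ball p s. c + L y = - (d + M y)"
    \<comment> \<open>The negated affine map has constant \<open>- d\<close> and linear part
      \<open>- M\<close>, which reduces this case to equality without sign.\<close>
    have "linear (\<lambda>y. - M y)" using M by (rule linear_compose_neg)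
    from affine_eq_of_eq_on_ball[OF L this s, of p c "- d"] * 
    show ?thesis by simp
  qed
qed

text \<open>If 0 lay on both segments, \<open>y\<close> and \<open>- y\<close> would both be
  nonpositive multiples of \<open>x\<close>, forcing \<open>y = 0\<close>.\<close>

lemma zero_notin_segment_or_reflected:
  fixes x y :: "'a::real_vector"
  assumes "x \<noteq> 0" "y \<noteq> 0"
  shows "0 \<notin> closed_segment x y \<or> 0 \<notin> closed_segment x (- y)"
proof (rule ccontr)
  assume "\<not> ?thesis"
  then obtain u v where u: "0 = (1 - u) *\<^sub>R x + u *\<^sub>R y" "0 \<le> u" "u \<le> 1"
    and v: "0 = (1 - v) *\<^sub>R x + v *\<^sub>R (- y)" "0 \<le> v" "v \<le> 1"
    unfolding closed_segment_def by blast
  have u0: "u > 0" and v0: "v > 0" using u v assms by (cases "u = 0"; cases "v = 0"; force)+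
  \<comment> \<open>This combination of the two equations eliminates \<open>y\<close>.\<close>
  have "(v * (1 - u) + u * (1 - v)) *\<^sub>R x = v *\<^sub>R ((1 - u) *\<^sub>R x + u *\<^sub>R y) + u *\<^sub>R ((1 - v) *\<^sub>R x + v *\<^sub>R (- y))"
    by (simp only: scaleR_add_left scaleR_add_right scaleR_scaleR mult.commute[of u v] scaleR_minus_right) simp
  also have "\<dots> = 0" using u(1) v(1) by simp
  finally have "v * (1 - u) + u * (1 - v) = 0" using assms by simp
  moreover have "v * (1 - u) \<ge> 0" "u * (1 - v) \<ge> 0" using u v by auto
  ultimately have "v * (1 - u) = 0" by linarith
  then have "u = 1" using v0 by simp
  then show False using u assms by simp
qed

section \<open>Phase isometries: norm, oddness and local form\<close>

context
  fixes f :: "'a::real_normed_vector \<Rightarrow> 'b::real_normed_vector"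
  assumes surj: "surj f"
    and phase: "\<And>x y. {norm (f x + f y), norm (f x - f y)} = {norm (x + y), norm (x - y)}"
begin

lemma phase_cases:
  "norm (f x + f y) = norm (x + y) \<and> norm (f x - f y) = norm (x - y) \<or>
   norm (f x + f y) = norm (x - y) \<and> norm (f x - f y) = norm (x + y)"
  using phase[of x y] by (auto simp: doubleton_eq_iff)

lemma phase_norm: "norm (f x) = norm x"
proof -
  have "norm (2 *\<^sub>R f x) = norm (2 *\<^sub>R x)"
    \<comment> \<open>In the crossed case both norms vanish, so the equality still holds.\<close>
    using phase_cases[of x x] by (auto simp: scaleR_2)
  then show ?thesis by simp
qed

text \<open>Surjectivity supplies a preimage \<open>y\<close> of \<open>- f x\<close>. As
  \<open>f x + f y = 0\<close>, one of \<open>x + y\<close> and \<open>x - y\<close> vanishes, and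
  \<open>y = x\<close> is possible only if \<open>x = 0\<close>.\<close>

lemma phase_odd: "f (- x) = - f x"
proof -
  obtain y where y: "f y = - f x" using surj by (metis surjD)
  have "y = x \<or> y = - x" using phase_cases[of x y] y
    by (auto simp: eq_neg_iff_add_eq_0 add.commute)
  then show ?thesis
  proof
    assume "y = x"
    then have "f x = 0" using y by (metis neg_equal_0_iff_equal scaleR_2 scaleR_eq_0_iff add_eq_0_iff zero_neq_numeral)
    then show ?thesis using phase_norm[of x] phase_norm[of "-x"] by simp
  qed (use y in simp)
qed

text \<open>Near \<^term>\<open>x\<close> the sign of \<^term>\<open>f\<close> can be normalised by comparison with \<^term>\<open>f x\<close>; as
  \<^term>\<open>norm (y - z) < norm x\<close> and \<^term>\<open>norm (y + z) > norm x\<close> on the ball, this leaves no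
  ambiguity.\<close>
lemma local_isometry:
  assumes r: "r = norm x / 2"
  obtains g where "\<And>y. g y = f y \<or> g y = - f y" "g ` ball x r = ball (g x) r"
    "\<And>y z. y \<in> ball x r \<Longrightarrow> z \<in> ball x r \<Longrightarrow> dist (g y) (g z) = dist y z"
proof -
  define g where "g y = (if norm (f y - f x) = norm (y - x) then f y else - f y)" for y
  have pm: "g y = f y \<or> g y = - f y" for y by (simp add: g_def)
  have gx: "g x = f x" by (simp add: g_def)
  have gdx: "norm (g y - f x) = norm (y - x)" for y
  proof (cases "norm (f y - f x) = norm (y - x)")
    case False
    then have "norm (f y + f x) = norm (y - x)" using phase_cases[of y x] by blast
    then have "norm (- f y - f x) = norm (y - x)" by (metis minus_add_distrib norm_minus_cancel uminus_add_conv_diff add.commute)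
    then show ?thesis using False by (simp add: g_def)
  qed (simp add: g_def)
  have iso: "dist (g y) (g z) = dist y z" if "y \<in> ball x r" "z \<in> ball x r" for y z
  proof -
    have yz: "norm (y - x) < r" "norm (z - x) < r" using that by (auto simp: dist_norm norm_minus_commute)
    have "norm (g y - g z) \<le> norm (g y - f x) + norm (g z - f x)"
      by (metis dist_norm dist_triangle2)
    then have 1: "norm (g y - g z) < norm x" using yz gdx r by simp
    \<comment> \<open>Uses \<open>2 *\<^sub>R x = (y + z) - ((y - x) + (z - x))\<close>. The
      resulting bound excludes \<open>norm (g y - g z) = norm (y + z)\<close>.\<close>
    have "norm (2 *\<^sub>R x) \<le> norm (y + z) + norm ((y - x) + (z - x))"
      using norm_triangle_ineq4[of "y + z" "(y - x) + (z - x)"] by (simp add: scaleR_2)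
    moreover have "norm ((y - x) + (z - x)) < 2 * r" using norm_triangle_ineq[of "y - x" "z - x"] yz by simp
    ultimately have 2: "norm (y + z) > norm x" using r by simp
    have "norm (g y - g z) = norm (f y - f z) \<or> norm (g y - g z) = norm (f y + f z)"
      using pm[of y] pm[of z] norm_minus_commute[of "f y" "f z"] norm_minus_cancel[of "f y + f z"]
      by (auto simp del: norm_minus_cancel)
    then have "norm (g y - g z) = norm (y - z)" using phase_cases[of y z] 1 2 by auto
    then show ?thesis by (simp add: dist_norm)
  qed
  have "g ` ball x r = ball (g x) r"
  proof
    show "g ` ball x r \<subseteq> ball (g x) r"
      using gdx by (auto simp: gx dist_norm norm_minus_commute)
    show "ball (g x) r \<subseteq> g ` ball x r"
    proof
      fix w assume "w \<in> ball (g x) r"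
      then have w: "norm (w - f x) < r" by (simp add: gx dist_norm norm_minus_commute)
      obtain y where y: "f y = w" using surj by (metis surjD)
      show "w \<in> g ` ball x r"
      proof (cases "norm (w - f x) = norm (y - x)")
        case True
        then have "g y = w" by (simp add: g_def y)
        then show ?thesis using w True by (intro image_eqI[of _ _ y]) (auto simp: dist_norm norm_minus_commute)
      next
        case False
        \<comment> \<open>Here \<open>- y\<close> is the preimage near \<open>x\<close>. Its value
          \<open>f (- y) = - w\<close> is farther than \<open>r\<close> from \<open>f x\<close>, so
          \<open>g\<close> flips the sign and gives \<open>w\<close>.\<close>
        then have y': "norm (w - f x) = norm (- y - x)"
          using phase_cases[of y x] norm_minus_cancel[of "y + x"] by (auto simp: y simp del: norm_minus_cancel)
        have "norm (2 *\<^sub>R f x) \<le> norm (w + f x) + norm (w - f x)"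
          using norm_triangle_ineq4[of "w + f x" "w - f x"] by (simp add: scaleR_2)
        then have "norm (w + f x) > r" 
          unfolding norm_scaleR phase_norm using w r norm_ge_zero[of "w - f x"] by linarith
        moreover have "norm (- w - f x) = norm (w + f x)"
          using norm_minus_cancel[of "w + f x"] by (simp del: norm_minus_cancel)
        ultimately have "g (- y) = w" using y' w by (simp add: g_def phase_odd y)
        then show ?thesis using w y' by (intro image_eqI[of _ _ "- y"]) (auto simp: dist_norm norm_minus_commute)
      qed
    qed
  qed
  then show thesis using that pm iso by blast
qed

text \<open>The local isometry \<open>g\<close>, recentred at \<open>x\<close>, preserves midpoints
  on the ball of a third of the radius and does not increase norms there, so it is the restriction
  of a linear map.\<close>

lemma locally_affine:
  assumes "x \<noteq> 0"
  obtains s c L where "s > 0" "linear L" "\<And>y. y \<in> ball x s \<Longrightarrow> f y = c + L y \<or> f y = - (c + L y)"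
proof -
  define r where "r = norm x / 2"
  obtain g where pm: "\<And>y. g y = f y \<or> g y = - f y" and img: "g ` ball x r = ball (g x) r"
    and iso: "\<And>y z. y \<in> ball x r \<Longrightarrow> z \<in> ball x r \<Longrightarrow> dist (g y) (g z) = dist y z"
    using local_isometry[OF r_def] by metis
  define s where "s = r / 3"
  have s: "s > 0" "r > 0" "s < r" using assms by (auto simp: s_def r_def)
  define h where "h v = g (x + v) - g x" for v
  obtain L where L: "linear L" "\<And>v. v \<in> ball 0 s \<Longrightarrow> h v = L v"
  proof (rule midpoint_affine_extends_linear[OF s(1), of h])
    fix u v :: 'a assume "u \<in> ball 0 s" "v \<in> ball 0 s"
    then have "x + u \<in> ball x (r/3)" "x + v \<in> ball x (r/3)" by (auto simp: s_def dist_norm)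
    then have "g (midpoint (x + u) (x + v)) = midpoint (g (x + u)) (g (x + v))"
      using ball_isometry_midpoint[OF img iso] by blast
    moreover have "midpoint (x + u) (x + v) = x + midpoint u v"
      using midpoint_plus_self[of u v] by (simp add: midpoint_eq_iff)
    moreover have "midpoint (g (x + u) - g x) (g (x + v) - g x) = midpoint (g (x + u)) (g (x + v)) - g x"
      using midpoint_plus_self[of "g (x + u)" "g (x + v)"] by (simp add: midpoint_eq_iff)
    ultimately show "h (midpoint u v) = midpoint (h u) (h v)" by (simp add: h_def)
  next
    fix v :: 'a assume "v \<in> ball 0 s"
    then have "dist (g (x + v)) (g x) = dist (x + v) x" using s by (intro iso) (auto simp: dist_norm)
    then show "norm (h v) \<le> norm v" by (simp add: h_def dist_norm)
  qed blast
  have "f y = (g x - L x) + L y \<or> f y = - ((g x - L x) + L y)" if "y \<in> ball x s" for y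
  proof -
    have "h (y - x) = L (y - x)" using that by (intro L) (simp add: dist_norm norm_minus_commute)
    then have "g y = (g x - L x) + L y" using L(1) by (simp add: h_def linear_diff algebra_simps)
    then show ?thesis using pm[of y] by (metis minus_minus)
  qed
  then show thesis using that s L by blast
qed

section \<open>Continuation to a global linear map\<close>

text \<open>The validity of the formula near a point propagates along the connected segment, since
  \<open>f\<close> has some local affine form at each of its points, all nonzero.\<close>

lemma affine_along_segment:
  assumes L: "linear L" and s: "s > 0"
    and loc: "\<And>y. y \<in> ball x s \<Longrightarrow> f y = c + L y \<or> f y = - (c + L y)"
    and seg: "0 \<notin> closed_segment x z"
  shows "f z = c + L z \<or> f z = - (c + L z)"
proof -
  \<comment> \<open>A whole neighbourhood is demanded, because comparing two affine forms needs a
    ball.\<close>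
  define P where "P y \<longleftrightarrow> (\<exists>e>0. \<forall>w\<in>ball y e. f w = c + L w \<or> f w = - (c + L w))" for y
  have "P z"
  proof (rule connected_induction_simple[of "closed_segment x z" x z P])
    show "P x" using s loc P_def by blast
    fix a assume "a \<in> closed_segment x z"
    then have "a \<noteq> 0" using seg by blast
    then obtain e d M where e: "e > 0" and M: "linear M"
      and fM: "\<And>y. y \<in> ball a e \<Longrightarrow> f y = d + M y \<or> f y = - (d + M y)"
      using locally_affine by metis
    \<comment> \<open>Near \<open>p\<close> both affine forms equal \<open>f\<close> up to sign,
      hence they agree globally up to one sign, and the form valid around \<open>a\<close> carries
      the formula to \<open>q\<close>.\<close>
    have "P q" if p: "p \<in> ball a e" "P p" and q: "q \<in> ball a e" for p q
    proof -
      obtain e1 where e1: "e1 > 0" "\<And>w. w \<in> ball p e1 \<Longrightarrow> f w = c + L w \<or> f w = - (c + L w)"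
        using p P_def by blast
      obtain e2 where e2: "e2 > 0" "ball p e2 \<subseteq> ball a e"
        using p open_contains_ball open_ball by metis
      obtain e3 where e3: "e3 > 0" "ball q e3 \<subseteq> ball a e"
        using q open_contains_ball open_ball by metis
      have "(\<forall>z. c + L z = d + M z) \<or> (\<forall>z. c + L z = - (d + M z))"
      proof (rule affine_eq_up_to_sign_of_ball[OF L M, of "min e1 e2" p])
        show "min e1 e2 > 0" using e1 e2 by simp
        fix y assume "y \<in> ball p (min e1 e2)"
        then have "y \<in> ball p e1" "y \<in> ball a e" using e2 by auto
        then show "c + L y = d + M y \<or> c + L y = - (d + M y)" using e1(2) fM by (metis minus_minus)
      qed
      then have "f w = c + L w \<or> f w = - (c + L w)" if "w \<in> ball q e3" for w
        using fM[of w] that e3 by (metis minus_minus subsetD)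
      then show ?thesis using e3 P_def by blast
    qed
    then show "\<exists>T. openin (top_of_set (closed_segment x z)) T \<and> a \<in> T \<and> (\<forall>p\<in>T. \<forall>q\<in>T. P p \<longrightarrow> P q)"
      using \<open>a \<in> closed_segment x z\<close> e openin_open_Int[OF open_ball, of "closed_segment x z" a e]
      by (metis Int_iff centre_in_ball)
  qed auto
  then show ?thesis unfolding P_def by (metis centre_in_ball)
qed

lemma linear_up_to_sign:
  obtains U where "linear U" "\<And>y. f y = U y \<or> f y = - U y"
proof (cases "\<exists>x::'a. x \<noteq> 0")
  case False
  then have z: "x = 0" for x :: 'a by blast
  have "f y = 0" for y using phase_norm[of y] z[of y] by simp
  then show ?thesis using that[of "\<lambda>_. 0"] by (simp add: linear_zero)
next
  case True
  then obtain x :: 'a where x: "x \<noteq> 0" by blast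
  then obtain s c L where s: "s > 0" and L: "linear L"
    and loc: "\<And>y. y \<in> ball x s \<Longrightarrow> f y = c + L y \<or> f y = - (c + L y)"
    using locally_affine by metis
  have along: "f z = c + L z \<or> f z = - (c + L z)" if "0 \<notin> closed_segment x z" for z
    using affine_along_segment[OF L s loc that] by blast
  \<comment> \<open>On the segment from \<open>x\<close> towards 0, norm preservation reads
    \<open>norm (c + t *\<^sub>R L x) = t * norm x\<close>. Small \<open>t\<close> then leaves no
    room for a nonzero \<open>c\<close>.\<close>
  have bound: "norm c \<le> t * (norm x + norm (L x))" if t: "0 < t" "t \<le> 1" for t
  proof -
    have "0 \<notin> closed_segment x (t *\<^sub>R x)"
    proof
      assume "0 \<in> closed_segment x (t *\<^sub>R x)"
      then obtain u where u: "0 = (1 - u) *\<^sub>R x + u *\<^sub>R t *\<^sub>R x" "0 \<le> u" "u \<le> 1"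
        unfolding closed_segment_def by blast
      then have "((1 - u) + u * t) *\<^sub>R x = 0" by (simp add: scaleR_add_left)
      then have "(1 - u) + u * t = 0" using x by simp
      moreover have "u * t \<ge> 0" using u t by simp
      ultimately have "u = 1" "u * t = 0" using u by linarith+
      then show False using t by simp
    qed
    then have "f (t *\<^sub>R x) = c + L (t *\<^sub>R x) \<or> f (t *\<^sub>R x) = - (c + L (t *\<^sub>R x))" by (rule along)
    then have "norm (c + t *\<^sub>R L x) = t * norm x"
      using phase_norm[of "t *\<^sub>R x"] t L by (metis norm_minus_cancel norm_scaleR linear_scale abs_of_pos)
    then show ?thesis
      using norm_triangle_ineq4[of "c + t *\<^sub>R L x" "t *\<^sub>R L x"] t by (simp add: algebra_simps)
  qed
  have "c = 0"
  proof (rule ccontr)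
    assume "c \<noteq> 0"
    define K where "K = norm x + norm (L x)"
    have K: "K > 0" using x by (simp add: K_def add_pos_nonneg)
    \<comment> \<open>The second entry makes the bound at most \<open>norm c / 2\<close>; the first
      keeps \<open>t\<close> in the range where the bound is available.\<close>
    define t where "t = min 1 (norm c / (2 * K))"
    have "norm c \<le> t * K" using bound[of t] \<open>c \<noteq> 0\<close> K by (simp add: t_def K_def)
    also have "\<dots> \<le> norm c / (2 * K) * K" using K by (intro mult_right_mono) (auto simp: t_def)
    also have "\<dots> = norm c / 2" using K by simp
    finally show False using \<open>c \<noteq> 0\<close> by simp
  qed
  have "f y = L y \<or> f y = - L y" for y
  proof (cases "y = 0")
    case True
    then show ?thesis using phase_norm[of 0] L by (simp add: linear_0)
  next
    case False
    from zero_notin_segment_or_reflected[OF x this] show ?thesis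
    proof
      assume "0 \<notin> closed_segment x y"
      then show ?thesis using along[of y] \<open>c = 0\<close> by simp
    next
      assume "0 \<notin> closed_segment x (- y)"
      then have "f (- y) = L (- y) \<or> f (- y) = - L (- y)" using along[of "- y"] \<open>c = 0\<close> by simp
      then have "- f y = - L y \<or> - f y = L y" by (simp add: phase_odd linear_neg[OF L])
      then show ?thesis by (metis minus_minus)
    qed
  qed
  then show ?thesis using that L by blast
qed

end

section \<open>Phase equivalence to surjective linear isometries\<close>

theorem theorem4p2:
  fixes f :: "'a::real_normed_vector \<Rightarrow> 'b::real_normed_vector"
  assumes "surj f"
  shows "(\<forall>x y. {norm (f x + f y), norm (f x - f y)} = {norm (x + y), norm (x - y)}) \<longleftrightarrow>
    (\<exists>(U :: 'a \<Rightarrow> 'b) (\<sigma> :: 'a \<Rightarrow> real).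
       linear U \<and> surj U \<and> (\<forall>x y. dist (U x) (U y) = dist x y) \<and>
       (\<forall>x. \<sigma> x \<in> {-1, 1}) \<and> (\<forall>x. f x = \<sigma> x *\<^sub>R U x))"
    (is "?phase \<longleftrightarrow> ?equiv")
proof
  assume ?phase
  then have phase: "\<And>x y. {norm (f x + f y), norm (f x - f y)} = {norm (x + y), norm (x - y)}" by blast
  obtain U where U: "linear U" and fU: "\<And>y. f y = U y \<or> f y = - U y"
    using linear_up_to_sign[OF assms phase] by metis
  \<comment> \<open>Where both signs fit, that is where \<open>U x = 0\<close>, the value is
    1.\<close>
  define \<sigma> :: "'a \<Rightarrow> real" where "\<sigma> x = (if f x = U x then 1 else -1)" for x
  have "norm (U x) = norm x" for x
    using fU[of x] phase_norm[OF assms phase, of x] by (metis norm_minus_cancel)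
  then have "dist (U x) (U y) = dist x y" for x y
    using U by (simp add: dist_norm flip: linear_diff)
  moreover have "surj U"
  proof -
    \<comment> \<open>If \<open>w = f y\<close>, then \<open>w\<close> is the image under
      \<open>U\<close> of \<open>y\<close> or of \<open>- y\<close>.\<close>
    have "\<exists>x. w = U x" for w
    proof -
      obtain y where "w = f y" using assms by (metis surjD)
      then show ?thesis using fU[of y] linear_neg[OF U, of y] by metis
    qed
    then show ?thesis by (simp add: surj_def)
  qed
  moreover have "f x = \<sigma> x *\<^sub>R U x" for x using fU[of x] by (auto simp: \<sigma>_def)
  ultimately show ?equiv using U by (intro exI[of _ U] exI[of _ \<sigma>]) (auto simp: \<sigma>_def)
next
  assume ?equiv
  then obtain U and \<sigma> :: "'a \<Rightarrow> real" where U: "linear U" and iso: "\<And>x y. dist (U x) (U y) = dist x y"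
    and \<sigma>: "\<And>x. \<sigma> x = -1 \<or> \<sigma> x = 1" and f: "\<And>x. f x = \<sigma> x *\<^sub>R U x" by auto
  have n: "norm (U x) = norm x" for x using iso[of x 0] U by (simp add: linear_0)
  have p: "norm (U x + U y) = norm (x + y)" for x y using n[of "x + y"] U by (simp add: linear_add)
  have m: "norm (U x - U y) = norm (x - y)" for x y using n[of "x - y"] U by (simp add: linear_diff)
  \<comment> \<open>Together these cover all sign patterns: equal signs keep the two norms in place,
    opposite signs swap them.\<close>
  have p': "norm (- U x - U y) = norm (x + y)" for x y
    using p[of x y] norm_minus_cancel[of "U x + U y"] by (simp del: norm_minus_cancel)
  have m': "norm (- U x + U y) = norm (x - y)" for x y
    using m[of x y] norm_minus_cancel[of "U x - U y"] by (simp del: norm_minus_cancel)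
  show ?phase
  proof (intro allI)
    fix x y
    show "{norm (f x + f y), norm (f x - f y)} = {norm (x + y), norm (x - y)}"
      using \<sigma>[of x] \<sigma>[of y] p[of x y] m[of x y] p'[of x y] m'[of x y] by (auto simp: f)
  qed
qed

end
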